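(* Every matroid of rank three satisfies $(3/2)$-Ray$[2]$; that is, for every matroid $\mathcal{M}$ of rank three on ground set $E$, every $\mathbf{y}>\mathbf{0}$ and every four-element subset $S\subseteq E$, $2\,\Psi_2MS(\mathbf{y})\geq 3\,\Psi_3MS(\mathbf{y})$.
   Context: Let $\mathcal{M}$ be a matroid on a finite ground set $E$, identified with its set of bases. Write $\mathbf{y}>\mathbf{0}$ for an assignment of positive real weights $\mathbf{y}=(y_e)_{e\in E}$, and $\mathbf{y}^A=\prod_{e\in A}y_e$. For disjoint $I,J\subseteq E$ let $M_I^J(\mathbf{y})=\sum \mathbf{y}^{B\setminus I}$, the sum over all bases $B$ of $\mathcal{M}$ with $I\subseteq B\subseteq E\setminus J$. For $S\subseteq E$ and integer $k$ let $\Psi_k M S(\mathbf{y})=\sum_{A\subseteq S,\ |A|=k} M_A^{S\setminus A}(\mathbf{y})\,M_{S\setminus A}^{A}(\mathbf{y})$. The condition $\lambda$-Ray$[k]$ means: for all $\mathbf{y}>\mathbf{0}$ and all $S\subseteq E$ with $|S|=2k$, $\Psi_kMS(\mathbf{y})\geq\lambda\Psi_{k+1}MS(\mathbf{y})$. *)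

theory Defs
  imports Complex_Main
begin

locale matroid =
  fixes E :: "'a set" and \<B> :: "'a set set"
  assumes finite_ground: "finite E"
    and bases_subset: "B \<in> \<B> \<Longrightarrow> B \<subseteq> E"
    and bases_nonempty: "\<B> \<noteq> {}"
    and basis_exchange:
      "\<lbrakk>B \<in> \<B>; B' \<in> \<B>; e \<in> B - B'\<rbrakk> \<Longrightarrow> \<exists>f \<in> B' - B. insert f (B - {e}) \<in> \<B>"

definition matroid_rank :: "'a set set \<Rightarrow> nat" where
  "matroid_rank \<B> = Max (card ` \<B>)"

lemma (in matroid) card_basis_le:
  assumes "B \<in> \<B>" "B' \<in> \<B>"
  shows "card B \<le> card B'"
  using assms
proof (induction "card (B - B')" arbitrary: B rule: less_induct)
  case less
  have fin: "finite B" "finite B'"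
    using finite_subset[OF bases_subset finite_ground] less.prems by auto
  show ?case
  proof (cases "B \<subseteq> B'")
    case True
    then show ?thesis by (rule card_mono[OF fin(2)])
  next
    case False
    then obtain e where e: "e \<in> B - B'" by auto
    from basis_exchange[OF less.prems e]
    obtain f where f: "f \<in> B' - B" "insert f (B - {e}) \<in> \<B>" by blast
    have "insert f (B - {e}) - B' = (B - B') - {e}" using f(1) by auto
    then have "insert f (B - {e}) - B' \<subset> B - B'" using e by auto
    then have "card (insert f (B - {e}) - B') < card (B - B')"
      using fin by (intro psubset_card_mono) auto
    then have "card (insert f (B - {e})) \<le> card B'"
      by (rule less.hyps[OF _ f(2) less.prems(2)])
    moreover have "card (insert f (B - {e})) = card B"
    proof -
      have "card (insert f (B - {e})) = Suc (card (B - {e}))"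
        using f(1) fin by (intro card_insert_disjoint) auto
      also have "\<dots> = card B"
        using e fin(1) by (intro card_Suc_Diff1) auto
      finally show ?thesis .
    qed
    ultimately show ?thesis by simp
  qed
qed

lemma (in matroid) card_basis_eq_rank:
  assumes "B \<in> \<B>"
  shows "card B = matroid_rank \<B>"
proof -
  have "card ` \<B> = {card B}"
  proof
    show "card ` \<B> \<subseteq> {card B}"
    proof
      fix n assume "n \<in> card ` \<B>"
      then obtain B' where "B' \<in> \<B>" "n = card B'" by blast
      then show "n \<in> {card B}"
        using card_basis_le[OF assms, of B'] card_basis_le[OF _ assms, of B'] by simp
    qed
    show "{card B} \<subseteq> card ` \<B>" using assms by blast
  qed
  then show ?thesis by (simp add: matroid_rank_def)
qed

text \<open>Written \<open>M\<^sub>I\<^sup>J(y)\<close> in the literature; \<open>I\<close> and \<open>J\<close> are meant to be disjoint.\<close>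

definition basis_poly ::
    "'a set \<Rightarrow> 'a set set \<Rightarrow> 'a set \<Rightarrow> 'a set \<Rightarrow> ('a \<Rightarrow> real) \<Rightarrow> real" where
  "basis_poly E \<B> I J y = (\<Sum>B | B \<in> \<B> \<and> I \<subseteq> B \<and> B \<subseteq> E - J. \<Prod>e\<in>B - I. y e)"

text \<open>For negative integers \<open>k\<close> the sum would be empty, so indexing by naturals loses nothing.\<close>

definition Psi ::
    "'a set \<Rightarrow> 'a set set \<Rightarrow> nat \<Rightarrow> 'a set \<Rightarrow> ('a \<Rightarrow> real) \<Rightarrow> real" where
  "Psi E \<B> k S y =
     (\<Sum>A | A \<subseteq> S \<and> card A = k. basis_poly E \<B> A (S - A) y * basis_poly E \<B> (S - A) A y)"

definition Ray :: "real \<Rightarrow> nat \<Rightarrow> 'a set \<Rightarrow> 'a set set \<Rightarrow> bool" where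
  "Ray lam k E \<B> \<longleftrightarrow>
     (\<forall>y S. (\<forall>e\<in>E. y e > 0) \<longrightarrow> S \<subseteq> E \<longrightarrow> card S = 2 * k \<longrightarrow>
        Psi E \<B> k S y \<ge> lam * Psi E \<B> (k + 1) S y)"

end

theory Submission
  imports Defs
begin

text \<open>
  Let \<open>S = {a, b, c, d}\<close>. Then \<open>\<Psi>\<^sub>2\<close> and \<open>\<Psi>\<^sub>3\<close> are quadratic forms in the weights of \<open>E - S\<close>. The
  coefficient of \<open>y\<^sub>e y\<^sub>f\<close> counts ways to split \<open>{a, b, c, d, e, f}\<close> into two bases, with \<open>e\<close> and
  \<open>f\<close> separated for \<open>\<Psi>\<^sub>2\<close> and together for \<open>\<Psi>\<^sub>3\<close>. If some triple in \<open>S\<close> is not a basis, basis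
  exchange gives the inequality coefficientwise. Otherwise \<open>a, b, c, d\<close> are like four points of a
  projective plane in general position, and the coefficientwise inequality fails only when \<open>e\<close> and
  \<open>f\<close> are distinct diagonal points of this quadrangle (\<open>ab \<inter> cd\<close>, \<open>ac \<inter> bd\<close>, \<open>ad \<inter> bc\<close>). With
  \<open>p, q, r\<close> the total weights at the three diagonal points, the deficit is absorbed by the square
  terms, because \<open>(p - q)\<^sup>2 + (p - r)\<^sup>2 + (q - r)\<^sup>2 \<ge> 0\<close>.
\<close>

section \<open>Incidence patterns of two points with the six sides of a quadrangle\<close>

text \<open>
  In the next two lemmas \<open>ab\<close> says that a point \<open>e\<close> is off the line \<open>ab\<close> of the quadrangle, \<open>ab'\<close>
  says the same of \<open>f\<close>, and \<open>qa\<close> is the indicator of \<open>{a, e, f}\<close> being a basis. The cases below are: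
  general position, on one line, a diagonal point, parallel to a vertex, a loop.
\<close>

lemma incidence_types:
  fixes ab ac ad bc bd cd :: bool
  assumes "ab \<or> ac \<or> \<not> ad" "ab \<or> ad \<or> \<not> ac" "ac \<or> ad \<or> \<not> ab"
    "ab \<or> bc \<or> \<not> bd" "ab \<or> bd \<or> \<not> bc" "bc \<or> bd \<or> \<not> ab"
    "ac \<or> bc \<or> \<not> cd" "ac \<or> cd \<or> \<not> bc" "bc \<or> cd \<or> \<not> ac"
    "ad \<or> bd \<or> \<not> cd" "ad \<or> cd \<or> \<not> bd" "bd \<or> cd \<or> \<not> ad"
  shows "ab \<and> ac \<and> ad \<and> bc \<and> bd \<and> cd
    \<or> \<not> ab \<and> ac \<and> ad \<and> bc \<and> bd \<and> cd
    \<or> ab \<and> \<not> ac \<and> ad \<and> bc \<and> bd \<and> cd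
    \<or> ab \<and> ac \<and> \<not> ad \<and> bc \<and> bd \<and> cd
    \<or> ab \<and> ac \<and> ad \<and> \<not> bc \<and> bd \<and> cd
    \<or> ab \<and> ac \<and> ad \<and> bc \<and> \<not> bd \<and> cd
    \<or> ab \<and> ac \<and> ad \<and> bc \<and> bd \<and> \<not> cd
    \<or> \<not> ab \<and> ac \<and> ad \<and> bc \<and> bd \<and> \<not> cd
    \<or> ab \<and> \<not> ac \<and> ad \<and> bc \<and> \<not> bd \<and> cd
    \<or> ab \<and> ac \<and> \<not> ad \<and> \<not> bc \<and> bd \<and> cd
    \<or> \<not> ab \<and> \<not> ac \<and> \<not> ad \<and> bc \<and> bd \<and> cd
    \<or> \<not> ab \<and> ac \<and> ad \<and> \<not> bc \<and> \<not> bd \<and> cd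
    \<or> ab \<and> \<not> ac \<and> ad \<and> \<not> bc \<and> bd \<and> \<not> cd
    \<or> ab \<and> ac \<and> \<not> ad \<and> bc \<and> \<not> bd \<and> \<not> cd
    \<or> \<not> ab \<and> \<not> ac \<and> \<not> ad \<and> \<not> bc \<and> \<not> bd \<and> \<not> cd"
  using assms by (cases ab; cases ac; cases ad; cases bc; cases bd; simp)

lemma incidence_bound:
  fixes ab ac ad bc bd cd ab' ac' ad' bc' bd' cd' :: bool and qa qb qc qd :: real
  assumes e: "ab \<or> ac \<or> \<not> ad" "ab \<or> ad \<or> \<not> ac" "ac \<or> ad \<or> \<not> ab"
    "ab \<or> bc \<or> \<not> bd" "ab \<or> bd \<or> \<not> bc" "bc \<or> bd \<or> \<not> ab"
    "ac \<or> bc \<or> \<not> cd" "ac \<or> cd \<or> \<not> bc" "bc \<or> cd \<or> \<not> ac"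
    "ad \<or> bd \<or> \<not> cd" "ad \<or> cd \<or> \<not> bd" "bd \<or> cd \<or> \<not> ad"
    and f: "ab' \<or> ac' \<or> \<not> ad'" "ab' \<or> ad' \<or> \<not> ac'" "ac' \<or> ad' \<or> \<not> ab'"
    "ab' \<or> bc' \<or> \<not> bd'" "ab' \<or> bd' \<or> \<not> bc'" "bc' \<or> bd' \<or> \<not> ab'"
    "ac' \<or> bc' \<or> \<not> cd'" "ac' \<or> cd' \<or> \<not> bc'" "bc' \<or> cd' \<or> \<not> ac'"
    "ad' \<or> bd' \<or> \<not> cd'" "ad' \<or> cd' \<or> \<not> bd'" "bd' \<or> cd' \<or> \<not> ad'"
    and parallel: "\<not> ab \<and> \<not> ac \<longrightarrow> qa = 0" "\<not> ab \<and> \<not> bc \<longrightarrow> qb = 0" "\<not> ac \<and> \<not> bc \<longrightarrow> qc = 0" "\<not> ad \<and> \<not> bd \<longrightarrow> qd = 0"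
    "\<not> ab' \<and> \<not> ac' \<longrightarrow> qa = 0" "\<not> ab' \<and> \<not> bc' \<longrightarrow> qb = 0" "\<not> ac' \<and> \<not> bc' \<longrightarrow> qc = 0" "\<not> ad' \<and> \<not> bd' \<longrightarrow> qd = 0"
    and lines: "\<not> ab \<and> \<not> ab' \<longrightarrow> qa = 0 \<and> qb = 0" "\<not> ac \<and> \<not> ac' \<longrightarrow> qa = 0 \<and> qc = 0" "\<not> ad \<and> \<not> ad' \<longrightarrow> qa = 0 \<and> qd = 0"
    "\<not> bc \<and> \<not> bc' \<longrightarrow> qb = 0 \<and> qc = 0" "\<not> bd \<and> \<not> bd' \<longrightarrow> qb = 0 \<and> qd = 0" "\<not> cd \<and> \<not> cd' \<longrightarrow> qc = 0 \<and> qd = 0"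
    and le_1: "qa \<le> 1" "qb \<le> 1" "qc \<le> 1" "qd \<le> 1"
  defines "p \<equiv> of_bool (\<not> ab \<and> \<not> cd \<and> ac \<and> bd) :: real"
    and "q \<equiv> of_bool (\<not> ac \<and> \<not> bd \<and> ab \<and> cd) :: real"
    and "r \<equiv> of_bool (\<not> ad \<and> \<not> bc \<and> ab \<and> cd) :: real"
    and "p' \<equiv> of_bool (\<not> ab' \<and> \<not> cd' \<and> ac' \<and> bd') :: real"
    and "q' \<equiv> of_bool (\<not> ac' \<and> \<not> bd' \<and> ab' \<and> cd') :: real"
    and "r' \<equiv> of_bool (\<not> ad' \<and> \<not> bc' \<and> ab' \<and> cd') :: real"
  shows "4 * ((p - q) * (p' - q') + (p - r) * (p' - r') + (q - r) * (q' - r'))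
    \<le> 4 * (of_bool (ab \<and> cd') + of_bool (ab' \<and> cd) + (of_bool (ac \<and> bd') + of_bool (ac' \<and> bd))
       + (of_bool (ad \<and> bc') + of_bool (ad' \<and> bc)))
     - 3 * (qa + qb + qc + qd)"
  \<comment> \<open>Each point has one of fifteen patterns. In each of the 225 combinations the
    indicators become numerals, and the bounds on \<open>qa\<close>, \<open>qb\<close>,
    \<open>qc\<close>, \<open>qd\<close> leave linear arithmetic.\<close>
  using incidence_types[OF e] incidence_types[OF f] parallel lines le_1
  unfolding p_def q_def r_def p'_def q'_def r'_def
  by (elim disjE; simp)

section \<open>Exchange properties in rank three\<close>

locale rank_three_matroid = matroid +
  assumes rank: "matroid_rank \<B> = 3"
begin

text \<open>The set encoding makes this symmetric in its arguments; as bases have three elements, it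
  is false when two arguments coincide.\<close>

definition bas :: "'a \<Rightarrow> 'a \<Rightarrow> 'a \<Rightarrow> bool" where
  "bas x y z \<longleftrightarrow> {x, y, z} \<in> \<B>"

lemma bas_commute: "bas x y z = bas y x z" "bas x y z = bas x z y"
  by (simp_all add: bas_def insert_commute)

lemma card_basis: "B \<in> \<B> \<Longrightarrow> card B = 3"
  using card_basis_eq_rank rank by simp

lemma bas_distinct:
  assumes "bas x y z"
  shows "x \<noteq> y" "x \<noteq> z" "y \<noteq> z"
  using card_basis[of "{x, y, z}"] assms
  by (auto simp: bas_def card_insert_if split: if_splits)

lemma exchange:
  assumes "bas x y z" "bas u v w"
  shows "bas u y z \<or> bas v y z \<or> bas w y z"
proof (cases "x \<in> {u, v, w}")
  case True
  then show ?thesis using assms by auto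
next
  case False
  then obtain g where "g \<in> {u, v, w}" "insert g ({x, y, z} - {x}) \<in> \<B>"
    using basis_exchange[of "{x, y, z}" "{u, v, w}" x] assms by (auto simp: bas_def)
  moreover have "{x, y, z} - {x} = {y, z}"
    using bas_distinct[OF assms(1)] by auto
  ultimately show ?thesis by (auto simp: bas_def)
qed

text \<open>A perfect matching in the rank-two contraction at \<open>x\<close>. By exchange each of
  \<open>a\<close>, \<open>b\<close> is independent of one of \<open>c\<close>, \<open>d\<close>,
  and conversely; a 2 by 2 zero-one array without a zero row or column contains a
  permutation.\<close>

lemma exchange_at_point:
  assumes "bas x a b" "bas x c d"
  shows "bas x a c \<and> bas x b d \<or> bas x a d \<and> bas x b c"
proof -
  have E: "bas x v c \<or> bas x v d" if "bas x u v" for u v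
    using exchange[of u x v x c d] that assms(2) bas_commute bas_distinct by metis
  have F: "bas x v a \<or> bas x v b" if "bas x u v" for u v
    using exchange[of u x v x a b] that assms(1) bas_commute bas_distinct by metis
  show ?thesis
    using E[of a b] E[of b a] F[of c d] F[of d c] assms bas_commute by metis
qed

text \<open>Here \<open>w\<close> lies on the line \<open>xy\<close> and \<open>z\<close> off it.
  Neither \<open>xy\<close> nor \<open>zw\<close> contains both \<open>e\<close> and
  \<open>f\<close>, and neither \<open>e\<close> nor \<open>f\<close> lies on both lines. So the 2
  by 2 array of lines against points again contains a permutation.\<close>

lemma separating_exchange:
  assumes "bas x y z" "bas w e f" "\<not> bas x y w"
  shows "bas x y e \<and> bas z w f \<or> bas x y f \<and> bas z w e"
proof -
  have ef: "bas x y e \<or> bas x y f"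
    using exchange[of z x y w e f] assms bas_commute by metis
  \<comment> \<open>A point of \<open>xy\<close> that is independent of \<open>w\<close> spans with
    \<open>w\<close> the line \<open>xy\<close>, which misses \<open>z\<close>.\<close>
  have span: "bas z w h \<or> bas x y h" if "bas w g h" for g h
  proof -
    have "bas x w h \<or> bas y w h \<or> bas z w h"
      using exchange[of g w h x y z] that assms(1) bas_commute by metis
    moreover have "bas x y h" if "bas x w h"
      using exchange_at_point[of x y z w h] that assms bas_commute by metis
    moreover have "bas x y h" if "bas y w h"
      using exchange_at_point[of y x z w h] that assms bas_commute by metis
    ultimately show ?thesis by blast
  qed
  \<comment> \<open>Some \<open>v\<close> among \<open>x\<close>, \<open>y\<close> makes
    \<open>w, v, z\<close> a basis. Exchanging at \<open>w\<close> against \<open>w, e, f\<close>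
    then puts \<open>e\<close> or \<open>f\<close> off the line \<open>zw\<close>.\<close>
  have "bas z w f \<or> bas z w e"
  proof (rule ccontr)
    assume h: "\<not> ?thesis"
    then have "bas w f x \<or> bas w f y"
      using exchange[of e w f x y z] assms bas_commute by metis
    then have "bas w x z \<or> bas w y z"
      using exchange[of f w x x y z] exchange[of f w y x y z] assms bas_commute bas_distinct
      by metis
    then show False
      using exchange_at_point[of w e f x z] exchange_at_point[of w e f y z] assms h bas_commute
      by metis
  qed
  then show ?thesis
    using ef span[of e f] span[of f e] assms bas_commute by metis
qed

section \<open>Coefficientwise inequalities\<close>

text \<open>
  Counts the splittings of \<open>{x, y, z, w, e, f}\<close> into two bases that separate \<open>{x, y}\<close> from \<open>{z, w}\<close>
  and \<open>e\<close> from \<open>f\<close>.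
\<close>

definition sep :: "'a \<Rightarrow> 'a \<Rightarrow> 'a \<Rightarrow> 'a \<Rightarrow> 'a \<Rightarrow> 'a \<Rightarrow> real" where
  "sep x y z w e f = of_bool (bas x y e \<and> bas z w f) + of_bool (bas x y f \<and> bas z w e)"

text \<open>In general position this is the indicator of a diagonal point; the last two conjuncts
  exclude exactly the loops, which lie on all six sides.\<close>

definition diagonal :: "'a \<Rightarrow> 'a \<Rightarrow> 'a \<Rightarrow> 'a \<Rightarrow> 'a \<Rightarrow> real" where
  "diagonal x y z w e = of_bool (\<not> bas x y e \<and> \<not> bas z w e \<and> bas x z e \<and> bas y w e)"

lemma sep_symmetric:
  "sep x y z w e f = sep y x z w e f" "sep x y z w e f = sep x y w z e f"
  "sep x y z w e f = sep z w x y e f"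
  by (simp_all add: sep_def bas_commute conj_commute add.commute)

text \<open>The last summand on the left vanishes. \<open>separating_exchange\<close> bounds each
  other one, with \<open>w\<close> the single point among \<open>a\<close>, \<open>b\<close>,
  \<open>c\<close> and \<open>z = d\<close>; the three choices of \<open>w\<close> give the three
  different pairings on the right.\<close>

lemma nongeneric_bound_aux:
  assumes "\<not> bas a b c"
  shows "of_bool (bas b c d \<and> bas a e f) + of_bool (bas a c d \<and> bas b e f)
      + of_bool (bas a b d \<and> bas c e f) + of_bool (bas a b c \<and> bas d e f)
    \<le> sep a b c d e f + sep a c b d e f + sep a d b c e f"
proof -
  have *: "of_bool (bas x y z \<and> bas w e f) \<le> sep x y z w e f" if "\<not> bas x y w" for x y z w
    using separating_exchange[of x y z w e f] that by (auto simp: sep_def)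
  have "of_bool (bas b c d \<and> bas a e f) \<le> sep a d b c e f"
    using *[of b c a d] assms sep_symmetric bas_commute by metis
  moreover have "of_bool (bas a c d \<and> bas b e f) \<le> sep a c b d e f"
    using *[of a c b d] assms sep_symmetric bas_commute by metis
  moreover have "of_bool (bas a b d \<and> bas c e f) \<le> sep a b c d e f"
    using *[of a b c d] assms sep_symmetric by metis
  ultimately show ?thesis using assms by simp
qed

lemma nongeneric_bound:
  assumes "\<not> (bas a b c \<and> bas a b d \<and> bas a c d \<and> bas b c d)"
  shows "of_bool (bas b c d \<and> bas a e f) + of_bool (bas a c d \<and> bas b e f)
      + of_bool (bas a b d \<and> bas c e f) + of_bool (bas a b c \<and> bas d e f)
    \<le> sep a b c d e f + sep a c b d e f + sep a d b c e f"
proof -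
  consider "\<not> bas a b c" | "\<not> bas a b d" | "\<not> bas a c d" | "\<not> bas b c d"
    using assms by blast
  then show ?thesis
  proof cases
    case 1
    then show ?thesis by (rule nongeneric_bound_aux)
  next
    case 2
    then show ?thesis
      using nongeneric_bound_aux[of a b d c e f]
      by (simp add: sep_symmetric bas_commute algebra_simps)
  next
    case 3
    then show ?thesis
      using nongeneric_bound_aux[of a c d b e f]
      by (simp add: sep_symmetric bas_commute algebra_simps)
  next
    case 4
    then show ?thesis
      using nongeneric_bound_aux[of b c d a e f]
      by (simp add: sep_symmetric bas_commute algebra_simps)
  qed
qed

text \<open>The three sides through a vertex are distinct lines, so a point on two of them is a loop
  or parallel to the vertex, hence on the third.\<close>

lemma star_incidence:
  assumes gen: "bas a b c" "bas a b d" "bas a c d" "bas b c d"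
  shows "bas a b e \<or> bas a c e \<or> \<not> bas a d e" "bas a b e \<or> bas a d e \<or> \<not> bas a c e" "bas a c e \<or> bas a d e \<or> \<not> bas a b e"
    "bas a b e \<or> bas b c e \<or> \<not> bas b d e" "bas a b e \<or> bas b d e \<or> \<not> bas b c e" "bas b c e \<or> bas b d e \<or> \<not> bas a b e"
    "bas a c e \<or> bas b c e \<or> \<not> bas c d e" "bas a c e \<or> bas c d e \<or> \<not> bas b c e" "bas b c e \<or> bas c d e \<or> \<not> bas a c e"
    "bas a d e \<or> bas b d e \<or> \<not> bas c d e" "bas a d e \<or> bas c d e \<or> \<not> bas b d e" "bas b d e \<or> bas c d e \<or> \<not> bas a d e"
proof -
  have star: "bas x y z \<Longrightarrow> bas x w e \<Longrightarrow> bas x y e \<or> bas x z e" for x y z w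
    using exchange_at_point[of x y z w e] by blast
  show "bas a b e \<or> bas a c e \<or> \<not> bas a d e" "bas a b e \<or> bas a d e \<or> \<not> bas a c e" "bas a c e \<or> bas a d e \<or> \<not> bas a b e"
    "bas a b e \<or> bas b c e \<or> \<not> bas b d e" "bas a b e \<or> bas b d e \<or> \<not> bas b c e" "bas b c e \<or> bas b d e \<or> \<not> bas a b e"
    "bas a c e \<or> bas b c e \<or> \<not> bas c d e" "bas a c e \<or> bas c d e \<or> \<not> bas b c e" "bas b c e \<or> bas c d e \<or> \<not> bas a c e"
    "bas a d e \<or> bas b d e \<or> \<not> bas c d e" "bas a d e \<or> bas c d e \<or> \<not> bas b d e" "bas b d e \<or> bas c d e \<or> \<not> bas a d e"
    using star[of a b c d] star[of a b d c] star[of a c d b]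
      star[of b a c d] star[of b a d c] star[of b c d a]
      star[of c a b d] star[of c a d b] star[of c b d a]
      star[of d a b c] star[of d a c b] star[of d b c a] gen
    by (auto simp: bas_commute)
qed

text \<open>The left side is chosen so that weighting by \<open>y e * y f\<close> and summing gives
  four times a sum of three squares. At two distinct diagonal points it is -4, and the right side
  drops to \<open>4 * 2 - 3 * 4\<close> when all four triples are bases.\<close>

lemma generic_bound:
  assumes gen: "bas a b c" "bas a b d" "bas a c d" "bas b c d"
  defines "p \<equiv> diagonal a b c d" and "q \<equiv> diagonal a c b d" and "r \<equiv> diagonal a d b c"
  shows "4 * ((p e - q e) * (p f - q f) + (p e - r e) * (p f - r f) + (q e - r e) * (q f - r f))
    \<le> 4 * (sep a b c d e f + sep a c b d e f + sep a d b c e f)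
      - 3 * (of_bool (bas a e f) + of_bool (bas b e f) + of_bool (bas c e f) + of_bool (bas d e f))"
proof -
  \<comment> \<open>If \<open>e\<close> and \<open>f\<close> lie on one side through
    \<open>x\<close>, then \<open>x, e, f\<close> are collinear.\<close>
  have line: "bas x y z \<Longrightarrow> bas x e f \<Longrightarrow> bas x y e \<or> bas x y f" for x y z
    using exchange_at_point[of x y z e f] by blast
  have lines: "\<not> bas a b e \<and> \<not> bas a b f \<longrightarrow>
      (of_bool (bas a e f) :: real) = 0 \<and> (of_bool (bas b e f) :: real) = 0"
    "\<not> bas a c e \<and> \<not> bas a c f \<longrightarrow>
      (of_bool (bas a e f) :: real) = 0 \<and> (of_bool (bas c e f) :: real) = 0"
    "\<not> bas a d e \<and> \<not> bas a d f \<longrightarrow>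
      (of_bool (bas a e f) :: real) = 0 \<and> (of_bool (bas d e f) :: real) = 0"
    "\<not> bas b c e \<and> \<not> bas b c f \<longrightarrow>
      (of_bool (bas b e f) :: real) = 0 \<and> (of_bool (bas c e f) :: real) = 0"
    "\<not> bas b d e \<and> \<not> bas b d f \<longrightarrow>
      (of_bool (bas b e f) :: real) = 0 \<and> (of_bool (bas d e f) :: real) = 0"
    "\<not> bas c d e \<and> \<not> bas c d f \<longrightarrow>
      (of_bool (bas c e f) :: real) = 0 \<and> (of_bool (bas d e f) :: real) = 0"
    using line[of a b c] line[of b a c] line[of a c b] line[of c a b] line[of a d b] line[of d a b]
      line[of b c a] line[of c b a] line[of b d a] line[of d b a] line[of c d a] line[of d c a] gen
    by (auto simp: bas_commute)
  \<comment> \<open>A point \<open>g\<close> on two sides through \<open>x\<close> is a loop or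
    parallel to \<open>x\<close>, so no basis contains both.\<close>
  have parallel: "bas x y z \<Longrightarrow> bas x e f \<Longrightarrow> g = e \<or> g = f \<Longrightarrow> bas x y g \<or> bas x z g" for x y z g
    using exchange_at_point[of x y z e f] by blast
  have parallels: "\<not> bas a b g \<and> \<not> bas a c g \<longrightarrow> (of_bool (bas a e f) :: real) = 0" "\<not> bas a b g \<and> \<not> bas b c g \<longrightarrow> (of_bool (bas b e f) :: real) = 0" "\<not> bas a c g \<and> \<not> bas b c g \<longrightarrow> (of_bool (bas c e f) :: real) = 0" "\<not> bas a d g \<and> \<not> bas b d g \<longrightarrow> (of_bool (bas d e f) :: real) = 0"
    if "g = e \<or> g = f" for g
    using parallel[of a b c, OF _ _ that] parallel[of b a c, OF _ _ that]
      parallel[of c a b, OF _ _ that] parallel[of d a b, OF _ _ that] gen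
    by (auto simp: bas_commute)
  have le_1: "(of_bool P :: real) \<le> 1" for P
    by simp
  have r: "diagonal a d b c g = of_bool (\<not> bas a d g \<and> \<not> bas b c g \<and> bas a b g \<and> bas c d g)" for g
    by (simp add: diagonal_def bas_commute)
  show ?thesis
    unfolding p_def q_def r_def r unfolding diagonal_def sep_def
    by (rule incidence_bound[OF star_incidence[OF gen, of e] star_incidence[OF gen, of f]
      parallels[of e] parallels[of f] lines le_1 le_1 le_1 le_1]) simp_all
qed

section \<open>From coefficients to quadratic forms\<close>

text \<open>For distinct vertices and \<open>F = E - {a, b, c, d}\<close> the two sides are six
  times \<Psi> at 3 and four times \<Psi> at 2.\<close>

lemma quadratic_bound:
  fixes y :: "'a \<Rightarrow> real"
  assumes nonneg: "\<And>e. e \<in> F \<Longrightarrow> y e \<ge> 0"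
  defines "L x z \<equiv> \<Sum>e\<in>F. of_bool (bas x z e) * y e"
    and "Q x \<equiv> \<Sum>e\<in>F. \<Sum>f\<in>F. of_bool (bas x e f) * (y e * y f)"
  shows "3 * (of_bool (bas b c d) * Q a + of_bool (bas a c d) * Q b
      + of_bool (bas a b d) * Q c + of_bool (bas a b c) * Q d)
    \<le> 8 * (L a b * L c d + L a c * L b d + L a d * L b c)"
proof -
  \<comment> \<open>\<open>W h\<close> is the form with coefficients \<open>h\<close> over ordered
    pairs: it is monotone and linear in \<open>h\<close>, and coefficients \<open>g e * h f\<close>
    give a product of linear forms.\<close>
  define W where "W h = (\<Sum>e\<in>F. \<Sum>f\<in>F. h e f * (y e * y f))" for h :: "'a \<Rightarrow> 'a \<Rightarrow> real"
  have W_mono: "W h \<le> W k" if "\<And>e f. h e f \<le> k e f" for h k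
    unfolding W_def using nonneg that by (intro sum_mono mult_right_mono) auto
  have W_add: "W (\<lambda>e f. h e f + k e f) = W h + W k" for h k
    by (simp add: W_def distrib_right sum.distrib)
  have W_diff: "W (\<lambda>e f. h e f - k e f) = W h - W k" for h k
    by (simp add: W_def left_diff_distrib sum_subtractf)
  have W_cmult: "W (\<lambda>e f. t * h e f) = t * W h" for t h
    by (simp add: W_def sum_distrib_left mult.assoc)
  have W_product: "W (\<lambda>e f. g e * h f) = (\<Sum>e\<in>F. g e * y e) * (\<Sum>f\<in>F. h f * y f)" for g h
    by (simp add: W_def sum_product mult_ac)
  have W_square: "0 \<le> W (\<lambda>e f. g e * g f)" for g
    by (simp add: W_product)
  have W_sep: "W (sep x z u v) = 2 * (L x z * L u v)" for x z u v
  proof -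
    have "sep x z u v = (\<lambda>e f. of_bool (bas x z e) * of_bool (bas u v f)
        + of_bool (bas u v e) * of_bool (bas x z f))"
      by (simp add: fun_eq_iff sep_def of_bool_conj mult.commute)
    then show ?thesis by (simp add: W_add W_product L_def)
  qed
  have Q: "Q x = W (\<lambda>e f. of_bool (bas x e f))" for x
    by (simp add: Q_def W_def)
  note W_linear = W_add W_diff W_cmult W_sep
  define s where "s e f = sep a b c d e f + sep a c b d e f + sep a d b c e f" for e f
  have s: "W s = 2 * (L a b * L c d + L a c * L b d + L a d * L b c)"
    by (simp add: s_def[abs_def] W_linear)
  show ?thesis
  proof (cases "bas a b c \<and> bas a b d \<and> bas a c d \<and> bas b c d")
    case True
    let ?p = "diagonal a b c d" and ?q = "diagonal a c b d" and ?r = "diagonal a d b c"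
    have "W (\<lambda>e f. 4 * ((?p e - ?q e) * (?p f - ?q f) + (?p e - ?r e) * (?p f - ?r f)
          + (?q e - ?r e) * (?q f - ?r f)))
        \<le> W (\<lambda>e f. 4 * s e f - 3 * (of_bool (bas a e f) + of_bool (bas b e f)
          + of_bool (bas c e f) + of_bool (bas d e f)))"
      using generic_bound[of a b c d] True by (intro W_mono) (simp add: s_def)
    then have "4 * (W (\<lambda>e f. (?p e - ?q e) * (?p f - ?q f)) + W (\<lambda>e f. (?p e - ?r e) * (?p f - ?r f))
          + W (\<lambda>e f. (?q e - ?r e) * (?q f - ?r f))) \<le> 4 * W s - 3 * (Q a + Q b + Q c + Q d)"
      by (simp only: W_linear Q)
    then show ?thesis
      using W_square[of "\<lambda>e. ?p e - ?q e"] W_square[of "\<lambda>e. ?p e - ?r e"]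
        W_square[of "\<lambda>e. ?q e - ?r e"] True s
      by simp
  next
    case False
    have "W (\<lambda>e f. of_bool (bas b c d) * of_bool (bas a e f) + of_bool (bas a c d) * of_bool (bas b e f)
        + of_bool (bas a b d) * of_bool (bas c e f) + of_bool (bas a b c) * of_bool (bas d e f)) \<le> W s"
      using nongeneric_bound[OF False] by (intro W_mono) (simp add: s_def of_bool_conj)
    then have "of_bool (bas b c d) * Q a + of_bool (bas a c d) * Q b
        + of_bool (bas a b d) * Q c + of_bool (bas a b c) * Q d \<le> W s"
      by (simp only: W_linear Q)
    then have "3 * (of_bool (bas b c d) * Q a + of_bool (bas a c d) * Q b
        + of_bool (bas a b d) * Q c + of_bool (bas a b c) * Q d) \<le> 3 * W s"
      by (rule mult_left_mono) simp
    \<comment> \<open>This case has the stronger factor 3; nonnegativity weakens it to the 4 of the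
      generic case.\<close>
    also have "0 \<le> W s"
      using W_mono[of "\<lambda>_ _. 0" s] by (simp add: W_def s_def sep_def)
    then have "3 * W s \<le> 4 * W s" by simp
    also have "\<dots> = 8 * (L a b * L c d + L a c * L b d + L a d * L b c)"
      by (simp add: s)
    finally show ?thesis .
  qed
qed

section \<open>Evaluating \<open>basis_poly\<close> when one, two or three points are
  prescribed\<close>

lemma basis_poly_triple:
  assumes "{a, b, c} \<subseteq> E - J" "card {a, b, c} = 3"
  shows "basis_poly E \<B> {a, b, c} J y = of_bool (bas a b c)"
proof -
  have "{B. B \<in> \<B> \<and> {a, b, c} \<subseteq> B \<and> B \<subseteq> E - J} = (if bas a b c then {{a, b, c}} else {})"
  proof -
    have "B = {a, b, c}" if "B \<in> \<B>" "{a, b, c} \<subseteq> B" for B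
      using card_subset_eq[of B "{a, b, c}"] that card_basis[of B] assms(2)
        finite_subset[OF bases_subset finite_ground] by auto
    then have "B \<in> \<B> \<and> {a, b, c} \<subseteq> B \<and> B \<subseteq> E - J \<longleftrightarrow> bas a b c \<and> B = {a, b, c}" for B
      using assms(1) unfolding bas_def by blast
    then show ?thesis by simp
  qed
  then show ?thesis by (simp add: basis_poly_def)
qed

lemma basis_poly_pair:
  assumes "a \<in> E - J" "b \<in> E - J" "a \<noteq> b"
  shows "basis_poly E \<B> {a, b} J y = (\<Sum>e\<in>E - ({a, b} \<union> J). of_bool (bas a b e) * y e)"
proof -
  let ?F = "{e \<in> E - ({a, b} \<union> J). bas a b e}"
  have "{B. B \<in> \<B> \<and> {a, b} \<subseteq> B \<and> B \<subseteq> E - J} = (\<lambda>e. {a, b, e}) ` ?F"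
  proof (intro equalityI subsetI)
    fix B assume "B \<in> {B. B \<in> \<B> \<and> {a, b} \<subseteq> B \<and> B \<subseteq> E - J}"
    then have B: "B \<in> \<B>" "{a, b} \<subseteq> B" "B \<subseteq> E - J" by auto
    then have "card (B - {a, b}) = 1"
      using assms(3) card_basis[of B] by (simp add: card_Diff_subset)
    then obtain e where e: "B - {a, b} = {e}" by (auto simp: card_1_singleton_iff)
    then have "B = {a, b, e}" "e \<in> E - ({a, b} \<union> J)" using B by auto
    then show "B \<in> (\<lambda>e. {a, b, e}) ` ?F" using B(1) by (auto simp: bas_def)
  qed (use assms in \<open>auto simp: bas_def\<close>)
  then have "basis_poly E \<B> {a, b} J y = (\<Sum>B\<in>(\<lambda>e. {a, b, e}) ` ?F. \<Prod>x\<in>B - {a, b}. y x)"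
    by (simp add: basis_poly_def)
  also have "\<dots> = (\<Sum>e\<in>?F. \<Prod>x\<in>{a, b, e} - {a, b}. y x)"
    by (intro sum.reindex_cong[OF _ refl refl]) (auto simp: inj_on_def)
  also have "\<dots> = (\<Sum>e\<in>?F. y e)"
  proof (rule sum.cong[OF refl])
    fix e assume "e \<in> ?F"
    then have "{a, b, e} - {a, b} = {e}" by auto
    then show "(\<Prod>x\<in>{a, b, e} - {a, b}. y x) = y e" by simp
  qed
  also have "\<dots> = (\<Sum>e\<in>E - ({a, b} \<union> J). of_bool (bas a b e) * y e)"
    using finite_ground by (intro sum.mono_neutral_cong_left) auto
  finally show ?thesis .
qed

text \<open>The factor 2 arises because a basis \<open>{a, u, v}\<close> comes from the ordered
  pairs \<open>(u, v)\<close> and \<open>(v, u)\<close>; terms with \<open>e = f\<close>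
  vanish.\<close>

lemma basis_poly_singleton:
  assumes "a \<in> E - J"
  shows "2 * basis_poly E \<B> {a} J y =
    (\<Sum>e\<in>E - insert a J. \<Sum>f\<in>E - insert a J. of_bool (bas a e f) * (y e * y f))"
proof -
  define F where "F = E - insert a J"
  define \<X> where "\<X> = {B. B \<in> \<B> \<and> {a} \<subseteq> B \<and> B \<subseteq> E - J}"
  define R where "R = {(e, f). e \<in> F \<and> f \<in> F \<and> bas a e f}"
  have fin: "finite F" "finite \<X>"
    using finite_ground by (auto simp: F_def \<X>_def intro: finite_subset[of _ "Pow E"] dest: bases_subset)
  have R: "R \<subseteq> F \<times> F" "finite R"
    using fin(1) by (auto simp: R_def intro: finite_subset[of _ "F \<times> F"])
  have "(\<Sum>e\<in>F. \<Sum>f\<in>F. of_bool (bas a e f) * (y e * y f))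
      = (\<Sum>(e, f)\<in>F \<times> F. of_bool (bas a e f) * (y e * y f))"
    by (simp add: sum.cartesian_product)
  also have "\<dots> = (\<Sum>(e, f)\<in>R. y e * y f)"
    using fin R by (intro sum.mono_neutral_cong_right) (auto simp: R_def)
  \<comment> \<open>The pairs are grouped by the basis that they complete; each fibre turns out to
    be the two orderings of \<open>B - {a}\<close>.\<close>
  also have "\<dots> = (\<Sum>B\<in>\<X>. \<Sum>(e, f) | (e, f) \<in> R \<and> {a, e, f} = B. y e * y f)"
    using sum.group[of R \<X> "\<lambda>(e, f). {a, e, f}" "\<lambda>(e, f). y e * y f"] fin R assms
    by (force simp: R_def F_def \<X>_def bas_def case_prod_unfold)
  also have "\<dots> = (\<Sum>B\<in>\<X>. 2 * (\<Prod>e\<in>B - {a}. y e))"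
  proof (rule sum.cong[OF refl])
    fix B assume "B \<in> \<X>"
    then have B: "B \<in> \<B>" "a \<in> B" "B \<subseteq> E - J" by (auto simp: \<X>_def)
    then have "card (B - {a}) = 2" using card_basis[of B] by simp
    then obtain u v where uv: "B - {a} = {u, v}" "u \<noteq> v" by (auto simp: card_2_iff)
    then have "B = {a, u, v}" using B by auto
    moreover have "{e, f} = {u, v}" if "(e, f) \<in> R" "{a, e, f} = {a, u, v}" for e f
    proof -
      have "a \<noteq> e" "a \<noteq> f" using that(1) bas_distinct[of a e f] by (auto simp: R_def)
      then have "{e, f} = {a, e, f} - {a}" by auto
      then show ?thesis using that(2) uv \<open>B = {a, u, v}\<close> by simp
    qed
    moreover have "(u, v) \<in> R" "(v, u) \<in> R"
      using uv B \<open>B = {a, u, v}\<close> bas_commute(2)[of a u v] by (auto simp: R_def F_def bas_def)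
    moreover have "{a, u, v} = {a, v, u}" by blast
    ultimately have "(e, f) \<in> R \<and> {a, e, f} = B \<longleftrightarrow> (e, f) = (u, v) \<or> (e, f) = (v, u)" for e f
      using \<open>B = {a, u, v}\<close> by (metis doubleton_eq_iff prod.inject)
    then have "{(e, f). (e, f) \<in> R \<and> {a, e, f} = B} = {(u, v), (v, u)}"
      by auto
    then show "(\<Sum>(e, f) | (e, f) \<in> R \<and> {a, e, f} = B. y e * y f) = 2 * (\<Prod>e\<in>B - {a}. y e)"
      using uv by simp
  qed
  finally show ?thesis
    by (simp add: basis_poly_def \<X>_def F_def sum_distrib_left)
qed

end

section \<open>Splittings of a four-element set and the final inequality\<close>

lemma subsets_of_four:
  assumes "distinct [a, b, c, d]"
  shows "{A. A \<subseteq> {a, b, c, d} \<and> card A = 2} = {{a, b}, {a, c}, {a, d}, {b, c}, {b, d}, {c, d}}"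
    and "{A. A \<subseteq> {a, b, c, d} \<and> card A = 3} = {{b, c, d}, {a, c, d}, {a, b, d}, {a, b, c}}"
proof -
  \<comment> \<open>Membership in \<open>Pow\<close> unfolds to the list of sixteen subsets, which
    cardinality then filters.\<close>
  have *: "A \<in> Pow {a, b, c, d}" if "A \<subseteq> {a, b, c, d}" for A
    using that by simp
  have two: "A \<in> {{a, b}, {a, c}, {a, d}, {b, c}, {b, d}, {c, d}}"
    if "A \<subseteq> {a, b, c, d}" "card A = 2" for A
    using *[OF that(1)] that(2) assms
    unfolding Pow_insert Pow_empty image_insert image_empty Un_insert_left Un_empty_left insert_iff empty_iff
    by (elim disjE; simp)
  show "{A. A \<subseteq> {a, b, c, d} \<and> card A = 2} = {{a, b}, {a, c}, {a, d}, {b, c}, {b, d}, {c, d}}"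
    using assms by (intro equalityI subsetI) (elim CollectE conjE, rule two, assumption+, auto)
  have three: "A \<in> {{b, c, d}, {a, c, d}, {a, b, d}, {a, b, c}}"
    if "A \<subseteq> {a, b, c, d}" "card A = 3" for A
    using *[OF that(1)] that(2) assms
    unfolding Pow_insert Pow_empty image_insert image_empty Un_insert_left Un_empty_left insert_iff empty_iff
    by (elim disjE; simp)
  show "{A. A \<subseteq> {a, b, c, d} \<and> card A = 3} = {{b, c, d}, {a, c, d}, {a, b, d}, {a, b, c}}"
    using assms by (intro equalityI subsetI) (elim CollectE conjE, rule three, assumption+, auto)
qed

theorem theorem5p1:
  fixes E :: "'a set" and \<B> :: "'a set set"
  assumes "matroid E \<B>" and "matroid_rank \<B> = 3"
  shows "Ray (3/2) 2 E \<B>"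
  unfolding Ray_def
proof (intro allI impI)
  interpret rank_three_matroid E \<B>
    using assms by (simp add: rank_three_matroid_def rank_three_matroid_axioms_def)
  fix y :: "'a \<Rightarrow> real" and S
  assume pos: "\<forall>e\<in>E. y e > 0" and S: "S \<subseteq> E" "card S = 2 * 2"
  obtain xs where xs: "set xs = S" "distinct xs" "length xs = 4"
    using finite_distinct_list[of S] S finite_subset[OF S(1) finite_ground]
    by (metis distinct_card mult_2 numeral_Bit0)
  then obtain a b c d where "xs = [a, b, c, d]"
    by (auto simp: eval_nat_numeral length_Suc_conv)
  then have dist: "distinct [a, b, c, d]" and S_eq: "S = {a, b, c, d}"
    using xs by auto
  define F where "F = E - S"
  define L where "L x z = (\<Sum>e\<in>F. of_bool (bas x z e) * y e)" for x z
  define Q where "Q x = (\<Sum>e\<in>F. \<Sum>f\<in>F. of_bool (bas x e f) * (y e * y f))" for x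
  have pair: "basis_poly E \<B> {u, v} J y = L u v" if "insert u (insert v J) = S" "u \<notin> J" "v \<notin> J" "u \<noteq> v" for u v J
    using that S(1) basis_poly_pair[of u J v y] by (auto simp: L_def F_def)
  have triple: "basis_poly E \<B> {u, v, w} {x} y = of_bool (bas u v w)"
    and single: "basis_poly E \<B> {x} {u, v, w} y = Q x / 2"
    if "{u, v, w, x} = S" "distinct [u, v, w, x]" for u v w x
  proof -
    show "basis_poly E \<B> {u, v, w} {x} y = of_bool (bas u v w)"
      using that S(1) by (intro basis_poly_triple) auto
    have "insert x {u, v, w} = S" using that(1) by auto
    then show "basis_poly E \<B> {x} {u, v, w} y = Q x / 2"
      using that S(1) basis_poly_singleton[of x "{u, v, w}" y] by (auto simp: Q_def F_def)
  qed
  have diffs: "S - {a, b} = {c, d}" "S - {a, c} = {b, d}" "S - {a, d} = {b, c}"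
    "S - {b, c} = {a, d}" "S - {b, d} = {a, c}" "S - {c, d} = {a, b}"
    "S - {b, c, d} = {a}" "S - {a, c, d} = {b}" "S - {a, b, d} = {c}" "S - {a, b, c} = {d}"
    using dist by (auto simp: S_eq)
  \<comment> \<open>The factor 2 appears because \<open>A\<close> and \<open>S - A\<close>
    contribute the same product.\<close>
  have Psi_2: "Psi E \<B> 2 S y = 2 * (L a b * L c d + L a c * L b d + L a d * L b c)"
  proof -
    have "basis_poly E \<B> {a, b} {c, d} y = L a b" "basis_poly E \<B> {c, d} {a, b} y = L c d"
      "basis_poly E \<B> {a, c} {b, d} y = L a c" "basis_poly E \<B> {b, d} {a, c} y = L b d"
      "basis_poly E \<B> {a, d} {b, c} y = L a d" "basis_poly E \<B> {b, c} {a, d} y = L b c"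
      using dist by (auto intro!: pair simp: S_eq)
    then show ?thesis
      unfolding Psi_def S_eq subsets_of_four(1)[OF dist] unfolding S_eq[symmetric]
      using dist by (simp add: diffs doubleton_eq_iff algebra_simps)
  qed
  \<comment> \<open>Doubling clears the halves in \<open>Q x / 2\<close>.\<close>
  have Psi_3: "2 * Psi E \<B> (2 + 1) S y = of_bool (bas b c d) * Q a + of_bool (bas a c d) * Q b
      + of_bool (bas a b d) * Q c + of_bool (bas a b c) * Q d"
  proof -
    have "{b, c, d} \<noteq> {a, c, d}" "{b, c, d} \<noteq> {a, b, d}" "{b, c, d} \<noteq> {a, b, c}"
      "{a, c, d} \<noteq> {a, b, d}" "{a, c, d} \<noteq> {a, b, c}" "{a, b, d} \<noteq> {a, b, c}"
      using dist by auto
    moreover have "basis_poly E \<B> {b, c, d} {a} y = of_bool (bas b c d)"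
      "basis_poly E \<B> {a, c, d} {b} y = of_bool (bas a c d)"
      "basis_poly E \<B> {a, b, d} {c} y = of_bool (bas a b d)"
      "basis_poly E \<B> {a, b, c} {d} y = of_bool (bas a b c)"
      "basis_poly E \<B> {a} {b, c, d} y = Q a / 2" "basis_poly E \<B> {b} {a, c, d} y = Q b / 2"
      "basis_poly E \<B> {c} {a, b, d} y = Q c / 2" "basis_poly E \<B> {d} {a, b, c} y = Q d / 2"
      by (rule triple single; use dist in \<open>auto simp: S_eq\<close>)+
    moreover have "2 + 1 = (3::nat)" by simp
    ultimately show ?thesis
      unfolding Psi_def S_eq by (simp only: subsets_of_four(2)[OF dist])
        (simp add: S_eq[symmetric] diffs del: of_bool_eq_0_iff)
  qed
  have "3 * (2 * Psi E \<B> (2 + 1) S y) \<le> 8 * (L a b * L c d + L a c * L b d + L a d * L b c)"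
    unfolding L_def Psi_3 Q_def using pos by (intro quadratic_bound) (auto simp: F_def less_imp_le)
  also have "\<dots> = 4 * Psi E \<B> 2 S y"
    by (simp add: Psi_2)
  finally show "Psi E \<B> 2 S y \<ge> 3 / 2 * Psi E \<B> (2 + 1) S y"
    by simp
qed

end
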